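(* Let $f:\mathbb{R}^n\to\mathbb{R}$ be convex, twice continuously differentiable, coercive, and strongly convex on bounded subsets of $\mathbb{R}^n$. Fix $\beta>0$, $x_0,\dot x_0\in\mathbb{R}^n$, and initial values $\varepsilon_0>0$, $\varepsilon_0'\le 0$, $\alpha_0\ge0$. Let $x_N:[0,+\infty)\to\mathbb{R}^n$ be the solution of $$\beta\nabla^2f(x_N(t))\dot x_N(t)+\nabla f(x_N(t))=0,\quad t\ge0,\qquad x_N(0)=x_0,$$ and let $c_1,c_2\ge0$. There exist constants $C,\tilde C\ge0$, depending on $c_1,c_2,\varepsilon_0,\alpha_0$ and the initial conditions (and on $f,\beta$, but not otherwise on $\varepsilon$ and $\alpha$), such that for every pair of functions $\varepsilon,\alpha:[0,+\infty)\to\mathbb{R}$ satisfying (a) $\alpha$ is non-increasing, non-negative, differentiable, with $\alpha(0)=\alpha_0$; $\varepsilon$ is non-increasing, positive, twice differentiable with bounded second derivative, with $\varepsilon(0)=\varepsilon_0$ and $\varepsilon'(0)=\varepsilon_0'$; (b) for all $t\ge0$, $|\varepsilon'(t)|\le c_1\varepsilon(t)$ and $|\alpha'(t)|\le c_2\alpha(t)$; if $x$ denotes the solution of $$\varepsilon(t)\ddot x(t)+\alpha(t)\dot x(t)+\beta\nabla^2 f(x(t))\dot x(t)+\nabla f(x(t))=0,\quad t\ge 0,\qquad (x(0),\dot x(0))=(x_0,\dot x_0),$$ and $x_{LM}$ denotes the solution of $$\alpha(t)\dot x_{LM}(t)+\beta\nabla^2 f(x_{LM}(t))\dot x_{LM}(t)+\nabla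 f(x_{LM}(t))=0,\quad t\ge 0,\qquad x_{LM}(0)=x_0,$$ then for all $t\ge0$, $$\|x(t)-x_N(t)\|\le C\left[e^{-\frac t\beta}+\sqrt{\varepsilon(t)}+\alpha(t)+\int_0^te^{\frac1\beta(s-t)}\left(\sqrt{\varepsilon(s)}+\alpha(s)\right)\mathrm{d}s\right]$$ and $$\|x(t)-x_{LM}(t)\|\le \tilde C\left[e^{-\frac t\beta}+\sqrt{\varepsilon(t)}+\alpha(t)+\int_0^te^{\frac1\beta(s-t)}\left(\sqrt{\varepsilon(s)}+\alpha(s)\right)\mathrm{d}s\right].$$
   Context: $\mathbb{R}^n$ is equipped with a scalar product $\langle\cdot,\cdot\rangle$ and the induced norm $\|\cdot\|$. Coercive means $f(y)\to+\infty$ as $\|y\|\to+\infty$. Strongly convex on bounded subsets means that for every bounded set $K\subset\mathbb{R}^n$ there is $\mu_K>0$ such that $\langle\nabla f(y_1)-\nabla f(y_2),y_1-y_2\rangle\ge\mu_K\|y_1-y_2\|^2$ for all $y_1,y_2\in K$. Dots denote time derivatives. Under these assumptions all three initial value problems have unique global solutions on $[0,+\infty)$. *)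

theory Defs
  imports "HOL-Analysis.Analysis"
begin

definition grad :: "('a::euclidean_space \<Rightarrow> real) \<Rightarrow> 'a \<Rightarrow> 'a" where
  "grad f y = (THE D. GDERIV f y :> D)"

text \<open>Outside the points where the gradient is differentiable the value of \<open>hessian\<close> is
  unspecified, so it is only meaningful together with \<open>twice_cont_differentiable\<close>.\<close>

definition hessian :: "('a::euclidean_space \<Rightarrow> real) \<Rightarrow> 'a \<Rightarrow> 'a \<Rightarrow>\<^sub>L 'a" where
  "hessian f y = Blinfun (frechet_derivative (grad f) (at y))"

definition twice_cont_differentiable :: "('a::euclidean_space \<Rightarrow> real) \<Rightarrow> bool" where
  "twice_cont_differentiable f \<longleftrightarrow>
     (\<forall>y. f differentiable (at y)) \<and> (\<forall>y. grad f differentiable (at y)) \<and>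
     continuous_on UNIV (hessian f)"

definition coercive :: "('a::euclidean_space \<Rightarrow> real) \<Rightarrow> bool" where
  "coercive f \<longleftrightarrow> filterlim f at_top at_infinity"

definition strongly_convex_on_bounded :: "('a::euclidean_space \<Rightarrow> real) \<Rightarrow> bool" where
  "strongly_convex_on_bounded f \<longleftrightarrow>
     (\<forall>K. bounded K \<longrightarrow>
       (\<exists>\<mu>>0. \<forall>y1\<in>K. \<forall>y2\<in>K. (grad f y1 - grad f y2) \<bullet> (y1 - y2) \<ge> \<mu> * (norm (y1 - y2))\<^sup>2))"

text \<open>Functions of time have the domain \<open>[0, \<infinity>)\<close>; they are total functions on the reals
  whose values at negative times are irrelevant. Accordingly time derivatives are taken
  within \<open>{0..}\<close>, i.e. they are one-sided at \<open>0\<close>.\<close>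

definition time_deriv :: "(real \<Rightarrow> 'b::real_normed_vector) \<Rightarrow> real \<Rightarrow> 'b" where
  "time_deriv u t = vector_derivative u (at t within {0..})"

definition newton_solution ::
  "('a::euclidean_space \<Rightarrow> real) \<Rightarrow> real \<Rightarrow> 'a \<Rightarrow> (real \<Rightarrow> 'a) \<Rightarrow> bool" where
  "newton_solution f \<beta> x0 x \<longleftrightarrow>
     x differentiable_on {0..} \<and>
     (\<forall>t\<ge>0. \<beta> *\<^sub>R hessian f (x t) (time_deriv x t) + grad f (x t) = 0) \<and>
     x 0 = x0"

definition levenberg_marquardt_solution ::
  "('a::euclidean_space \<Rightarrow> real) \<Rightarrow> real \<Rightarrow> (real \<Rightarrow> real) \<Rightarrow> 'a \<Rightarrow> (real \<Rightarrow> 'a) \<Rightarrow> bool" where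
  "levenberg_marquardt_solution f \<beta> \<alpha> x0 x \<longleftrightarrow>
     x differentiable_on {0..} \<and>
     (\<forall>t\<ge>0. \<alpha> t *\<^sub>R time_deriv x t + \<beta> *\<^sub>R hessian f (x t) (time_deriv x t) + grad f (x t) = 0) \<and>
     x 0 = x0"

definition inertial_newton_solution ::
  "('a::euclidean_space \<Rightarrow> real) \<Rightarrow> real \<Rightarrow> (real \<Rightarrow> real) \<Rightarrow> (real \<Rightarrow> real) \<Rightarrow> 'a \<Rightarrow> 'a \<Rightarrow> (real \<Rightarrow> 'a) \<Rightarrow> bool"
  where
  "inertial_newton_solution f \<beta> \<epsilon> \<alpha> x0 v0 x \<longleftrightarrow>
     x differentiable_on {0..} \<and> time_deriv x differentiable_on {0..} \<and>
     (\<forall>t\<ge>0. \<epsilon> t *\<^sub>R time_deriv (time_deriv x) t + \<alpha> t *\<^sub>R time_deriv x t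
            + \<beta> *\<^sub>R hessian f (x t) (time_deriv x t) + grad f (x t) = 0) \<and>
     x 0 = x0 \<and> time_deriv x 0 = v0"

definition admissible_damping :: "real \<Rightarrow> real \<Rightarrow> (real \<Rightarrow> real) \<Rightarrow> bool" where
  "admissible_damping c2 \<alpha>0 \<alpha> \<longleftrightarrow>
     antimono_on {0..} \<alpha> \<and> (\<forall>t\<ge>0. \<alpha> t \<ge> 0) \<and> \<alpha> differentiable_on {0..} \<and> \<alpha> 0 = \<alpha>0 \<and>
     (\<forall>t\<ge>0. \<bar>time_deriv \<alpha> t\<bar> \<le> c2 * \<alpha> t)"

definition admissible_mass :: "real \<Rightarrow> real \<Rightarrow> real \<Rightarrow> (real \<Rightarrow> real) \<Rightarrow> bool" where
  "admissible_mass c1 \<epsilon>0 \<epsilon>0' \<epsilon> \<longleftrightarrow>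
     antimono_on {0..} \<epsilon> \<and> (\<forall>t\<ge>0. \<epsilon> t > 0) \<and>
     \<epsilon> differentiable_on {0..} \<and> time_deriv \<epsilon> differentiable_on {0..} \<and>
     bounded (time_deriv (time_deriv \<epsilon>) ` {0..}) \<and>
     \<epsilon> 0 = \<epsilon>0 \<and> time_deriv \<epsilon> 0 = \<epsilon>0' \<and>
     (\<forall>t\<ge>0. \<bar>time_deriv \<epsilon> t\<bar> \<le> c1 * \<epsilon> t)"

end

theory Submission
  imports Defs
begin

text \<open>For a mass \<open>\<epsilon>\<close> and a damping \<open>\<alpha>\<close> the energy \<open>f x + \<epsilon> \<parallel>x'\<parallel>\<^sup>2 / 2\<close> is non-increasing along the
  inertial trajectory, so all trajectories stay in one bounded sublevel set of \<open>f\<close> and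
  \<open>\<epsilon> \<parallel>x'\<parallel> = O(sqrt \<epsilon>)\<close>. The Newton flow is the Levenberg--Marquardt flow \<open>y\<close> with damping \<open>a = 0\<close>,
  so both estimates are one comparison. The point is to absorb the accelerations into
  \<open>z = \<epsilon> x' + \<alpha> x - a y + \<beta> (\<nabla>f x - \<nabla>f y)\<close>: both equations together say that
  \<open>z' + z / \<beta> = \<epsilon>' x' + \<alpha>' x - a' y + (\<epsilon> x' + \<alpha> x - a y) / \<beta> = O(sqrt \<epsilon> + \<alpha>)\<close>. Integrating
  bounds \<open>z\<close>, hence \<open>\<nabla>f x - \<nabla>f y\<close>, hence \<open>x - y\<close> by strong convexity.\<close>

section \<open>Gradient, Hessian and chain rules\<close>

text \<open>Justifies the definite description behind \<open>grad\<close>. Existence is the Riesz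
  representation, with coordinates \<open>f' b\<close> on the basis; two candidates \<open>E\<close>
  and \<open>D\<close> agree because their difference, tested against itself, has norm zero.\<close>

lemma grad_has_derivative:
  fixes f :: "'a::euclidean_space \<Rightarrow> real"
  assumes "f differentiable (at y)"
  shows "(f has_derivative (\<lambda>h. grad f y \<bullet> h)) (at y)"
proof -
  obtain f' where f': "(f has_derivative f') (at y)"
    using assms by (auto simp: differentiable_def)
  define D where "D = (\<Sum>b\<in>Basis. f' b *\<^sub>R b)"
  have lin: "linear f'"
    using f' by (rule has_derivative_linear)
  have "f' h = D \<bullet> h" for h
  proof -
    have "f' h = f' (\<Sum>b\<in>Basis. (h \<bullet> b) *\<^sub>R b)"
      by (simp add: euclidean_representation)
    also have "\<dots> = D \<bullet> h"
      by (simp add: linear_sum[OF lin] linear_scale[OF lin] D_def inner_sum_left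
          inner_commute[of h] mult.commute)
    finally show ?thesis .
  qed
  then have "f' = (\<lambda>h. D \<bullet> h)" by auto
  with f' have D: "GDERIV f y :> D"
    by (simp add: gderiv_def inner_commute)
  moreover have "E = D" if "GDERIV f y :> E" for E
  proof -
    have "(\<lambda>h. h \<bullet> E) = (\<lambda>h. h \<bullet> D)"
      using that D unfolding gderiv_def by (rule has_derivative_unique)
    then have "(E - D) \<bullet> E = (E - D) \<bullet> D" by meson
    then have "(E - D) \<bullet> (E - D) = 0" by (simp add: inner_diff_right)
    then show ?thesis by simp
  qed
  ultimately have "grad f y = D"
    unfolding grad_def by (rule the_equality)
  with D show ?thesis by (simp add: gderiv_def inner_commute)
qed

lemma hessian_has_derivative:
  fixes f :: "'a::euclidean_space \<Rightarrow> real"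
  assumes "grad f differentiable (at y)"
  shows "(grad f has_derivative blinfun_apply (hessian f y)) (at y)"
proof -
  have d: "(grad f has_derivative frechet_derivative (grad f) (at y)) (at y)"
    using assms frechet_derivative_works by blast
  then have "blinfun_apply (hessian f y) = frechet_derivative (grad f) (at y)"
    unfolding hessian_def by (intro bounded_linear_Blinfun_apply has_derivative_bounded_linear)
  with d show ?thesis by simp
qed

lemma grad_chain:
  fixes f :: "'a::euclidean_space \<Rightarrow> real"
  assumes "f differentiable (at (x t))" and "(x has_vector_derivative v) (at t within S)"
  shows "((\<lambda>t. f (x t)) has_real_derivative (grad f (x t) \<bullet> v)) (at t within S)"
  using vector_derivative_diff_chain_within[OF assms(2)
      has_derivative_at_withinI[OF grad_has_derivative[OF assms(1)]]]
  by (simp add: o_def has_real_derivative_iff_has_vector_derivative)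

lemma hessian_chain:
  fixes f :: "'a::euclidean_space \<Rightarrow> real"
  assumes "grad f differentiable (at (x t))" and "(x has_vector_derivative v) (at t within S)"
  shows "((\<lambda>t. grad f (x t)) has_vector_derivative hessian f (x t) v) (at t within S)"
  using vector_derivative_diff_chain_within[OF assms(2)
      has_derivative_at_withinI[OF hessian_has_derivative[OF assms(1)]]]
  by (simp add: o_def)

text \<open>The Hessian form is the right-hand limit of difference quotients of
  \<open>grad f\<close> along the line through \<open>y\<close> in direction \<open>h\<close>, and
  monotonicity of the gradient makes these quotients non-negative. The lemma gives the sign of the
  Hessian damping in both energy estimates.\<close>

lemma hessian_nonneg:
  fixes f :: "'a::euclidean_space \<Rightarrow> real"
  assumes "strongly_convex_on_bounded f" and diff: "grad f differentiable (at y)"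
  shows "hessian f y h \<bullet> h \<ge> 0"
proof -
  have mono: "(grad f p - grad f q) \<bullet> (p - q) \<ge> 0" for p q
  proof -
    \<comment> \<open>A two-point set is bounded, so each pair of points has its own modulus, which
      is enough for plain monotonicity on the whole space.\<close>
    have "bounded {p, q}" by simp
    with assms(1) obtain \<mu> where "\<mu> > 0"
      and "\<forall>y1\<in>{p, q}. \<forall>y2\<in>{p, q}. (grad f y1 - grad f y2) \<bullet> (y1 - y2) \<ge> \<mu> * (norm (y1 - y2))\<^sup>2"
      unfolding strongly_convex_on_bounded_def by blast
    then have "(grad f p - grad f q) \<bullet> (p - q) \<ge> \<mu> * (norm (p - q))\<^sup>2" by blast
    moreover have "\<mu> * (norm (p - q))\<^sup>2 \<ge> 0" using \<open>\<mu> > 0\<close> by simp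
    ultimately show ?thesis by linarith
  qed
  define \<phi> where "\<phi> s = grad f (y + s *\<^sub>R h) \<bullet> h" for s :: real
  have "((\<lambda>s. y + s *\<^sub>R h) has_vector_derivative h) (at (0::real))"
    by (auto intro!: derivative_eq_intros)
  then have "((\<lambda>s. grad f (y + s *\<^sub>R h)) has_vector_derivative hessian f y h) (at 0)"
    using hessian_chain[of f "\<lambda>s. y + s *\<^sub>R h" 0 h UNIV] diff by simp
  then have "(\<phi> has_real_derivative hessian f y h \<bullet> h) (at 0)"
    unfolding \<phi>_def has_real_derivative_iff_has_vector_derivative
    by (rule bounded_linear.has_vector_derivative[OF bounded_linear_inner_left])
  then have lim: "((\<lambda>s. (\<phi> s - \<phi> 0) / s) \<longlongrightarrow> hessian f y h \<bullet> h) (at_right 0)"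
    unfolding has_field_derivative_iff by (auto intro: tendsto_within_subset)
  have "(\<phi> s - \<phi> 0) / s \<ge> 0" if "s > 0" for s
  proof -
    \<comment> \<open>The two points differ by \<open>s *\<^sub>R h\<close>, which produces the
      extra factor \<open>s\<close>.\<close>
    have "s * (\<phi> s - \<phi> 0) \<ge> 0"
      using mono[of "y + s *\<^sub>R h" y] by (simp add: \<phi>_def inner_diff_left)
    with that show ?thesis by (simp add: zero_le_mult_iff)
  qed
  then have "eventually (\<lambda>s. (\<phi> s - \<phi> 0) / s \<ge> 0) (at_right 0)"
    by (auto simp: eventually_at_right_less eventually_at_filter)
  with lim show ?thesis
    by (intro tendsto_lowerbound) auto
qed

section \<open>Consequences of coercivity\<close>

lemma coercive_bounded_sublevel:
  fixes f :: "'a::euclidean_space \<Rightarrow> real"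
  assumes "coercive f"
  shows "bounded {y. f y \<le> M}"
proof -
  have "eventually (\<lambda>y. f y \<ge> M + 1) at_infinity"
    using assms unfolding coercive_def filterlim_at_top by blast
  then obtain b where b: "\<And>y. norm y \<ge> b \<Longrightarrow> f y \<ge> M + 1"
    by (auto simp: eventually_at_infinity)
  then have "{y. f y \<le> M} \<subseteq> cball 0 b"
    by (smt (verit) mem_Collect_eq mem_cball_0 subsetI)
  then show ?thesis by (rule bounded_subset[OF bounded_cball])
qed

text \<open>The sublevel set at height \<open>f 0\<close> is compact and non-empty, so
  \<open>f\<close> has a minimum there, and outside the set \<open>f\<close> is larger than
  \<open>f 0\<close>.\<close>

lemma coercive_bounded_below:
  fixes f :: "'a::euclidean_space \<Rightarrow> real"
  assumes "coercive f" and cont: "continuous_on UNIV f"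
  shows "\<exists>m. \<forall>y. m \<le> f y"
proof -
  define S where "S = {y. f y \<le> f 0}"
  have "compact S"
    unfolding S_def compact_eq_bounded_closed
    using coercive_bounded_sublevel[OF assms(1)] closed_Collect_le[OF cont continuous_on_const]
    by simp
  moreover have "0 \<in> S" by (simp add: S_def)
  moreover have "continuous_on S f" using cont continuous_on_subset by blast
  ultimately obtain p where p: "p \<in> S" "\<forall>y\<in>S. f p \<le> f y"
    using continuous_attains_inf[of S f] by blast
  have "f p \<le> f y" for y
    using p \<open>0 \<in> S\<close> by (cases "y \<in> S") (auto simp: S_def)
  then show ?thesis by blast
qed

section \<open>Calculus on the closed half-line\<close>

lemma time_deriv_works:
  fixes u :: "real \<Rightarrow> 'b::real_normed_vector"
  assumes "u differentiable_on {0..}" and "t \<ge> 0"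
  shows "(u has_vector_derivative time_deriv u t) (at t within {0..})"
  using assms unfolding time_deriv_def differentiable_on_def
  by (auto simp: vector_derivative_works)

lemma has_integral_time_deriv:
  fixes u :: "real \<Rightarrow> 'b::banach"
  assumes "\<And>s. s \<ge> 0 \<Longrightarrow> (u has_vector_derivative u' s) (at s within {0..})" and "t \<ge> 0"
  shows "(u' has_integral (u t - u 0)) {0..t}"
  using assms(2)
  by (intro fundamental_theorem_of_calculus has_vector_derivative_within_subset[OF assms(1)]) auto

lemma nonincreasing_of_time_deriv:
  fixes u :: "real \<Rightarrow> real"
  assumes "\<And>s. s \<ge> 0 \<Longrightarrow> (u has_real_derivative u' s) (at s within {0..})"
    and "\<And>s. s \<ge> 0 \<Longrightarrow> u' s \<le> 0" and "t \<ge> 0"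
  shows "u t \<le> u 0"
proof -
  have "(u' has_integral (u t - u 0)) {0..t}"
    using assms(1,3)
    by (intro has_integral_time_deriv) (auto simp: has_real_derivative_iff_has_vector_derivative)
  moreover have "((\<lambda>_. 0::real) has_integral 0) {0..t}" by simp
  ultimately have "u t - u 0 \<le> 0"
    by (rule has_integral_le) (use assms(2) in auto)
  then show ?thesis by simp
qed

text \<open>Points of the half-line can always be approached from the right, including the endpoint
  0. Hence limits within \<open>{0..}\<close> are unique and preserve inequalities.\<close>

lemma at_within_atLeast_neq_bot:
  fixes t :: real
  assumes "t \<ge> 0"
  shows "at t within {0..} \<noteq> bot"
proof -
  have "at_right t \<le> at t within {0..}"
    using assms by (intro at_le) auto
  then show ?thesis
    using trivial_limit_at_right_real[of t] by (metis le_bot)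
qed

lemma time_deriv_const:
  assumes "t \<ge> 0"
  shows "time_deriv (\<lambda>_. c) t = 0"
  unfolding time_deriv_def
  using at_within_atLeast_neq_bot[OF assms] has_vector_derivative_const
  by (rule vector_derivative_within)

lemma antimono_on_imp_time_deriv_nonpos:
  fixes u :: "real \<Rightarrow> real"
  assumes "antimono_on {0..} u" and "u differentiable_on {0..}" and t: "t \<ge> 0"
  shows "time_deriv u t \<le> 0"
proof -
  have "(u has_real_derivative time_deriv u t) (at t within {0..})"
    using time_deriv_works[OF assms(2) t] by (simp add: has_real_derivative_iff_has_vector_derivative)
  then have "((\<lambda>s. (u s - u t) / (s - t)) \<longlongrightarrow> time_deriv u t) (at t within {0..})"
    by (simp add: has_field_derivative_iff)
  moreover have "(u s - u t) / (s - t) \<le> 0" if "s \<ge> 0" "s \<noteq> t" for s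
    using that t assms(1) by (cases "s < t") (auto simp: monotone_on_def divide_le_0_iff)
  then have "eventually (\<lambda>s. (u s - u t) / (s - t) \<le> 0) (at t within {0..})"
    by (auto simp: eventually_at_filter)
  ultimately show ?thesis
    using at_within_atLeast_neq_bot[OF t] by (intro tendsto_upperbound)
qed

text \<open>Variation of constants: the integrating factor
  \<open>exp (1 / \<beta> * (s - t))\<close> turns \<open>z' + z / \<beta>\<close> into an exact
  derivative, whose integral is then bounded in norm.\<close>

lemma linear_decay_estimate:
  fixes z :: "real \<Rightarrow> 'b::banach"
  assumes z: "\<And>s. s \<ge> 0 \<Longrightarrow> (z has_vector_derivative z' s) (at s within {0..})"
    and bound: "\<And>s. s \<ge> 0 \<Longrightarrow> norm (z' s + (1 / \<beta>) *\<^sub>R z s) \<le> D * g s"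
    and g: "continuous_on {0..} g" and \<beta>: "\<beta> > 0" and t: "t \<ge> 0"
  shows "norm (z t) \<le> exp (- t / \<beta>) * norm (z 0)
    + D * integral {0..t} (\<lambda>s. exp (1 / \<beta> * (s - t)) * g s)"
proof -
  \<comment> \<open>The factor is normalised to 1 at the final time, so that
    \<open>p t = z t\<close>, while \<open>p 0\<close> carries the decay
    \<open>exp (- t / \<beta>)\<close>.\<close>
  define p where "p s = exp (1 / \<beta> * (s - t)) *\<^sub>R z s" for s
  define p' where "p' s = exp (1 / \<beta> * (s - t)) *\<^sub>R (z' s + (1 / \<beta>) *\<^sub>R z s)" for s
  have "(p has_vector_derivative p' s) (at s within {0..})" if "s \<ge> 0" for s
  proof -
    have "((\<lambda>s. exp (1 / \<beta> * (s - t))) has_real_derivative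
        exp (1 / \<beta> * (s - t)) * (1 / \<beta>)) (at s within {0..})"
      using \<beta> by (auto intro!: derivative_eq_intros)
    from has_vector_derivative_scaleR[OF this z[OF that]] show ?thesis
      unfolding p_def p'_def by (simp add: scaleR_add_right)
  qed
  from has_integral_time_deriv[OF this t]
  have p'_int: "(p' has_integral (p t - p 0)) {0..t}" .
  have g_int: "(\<lambda>s. exp (1 / \<beta> * (s - t)) * g s) integrable_on {0..t}"
    by (intro integrable_continuous_real continuous_intros continuous_on_subset[OF g]) auto
  have "norm (integral {0..t} p') \<le> integral {0..t} (\<lambda>s. D * (exp (1 / \<beta> * (s - t)) * g s))"
  proof (rule integral_norm_bound_integral)
    show "p' integrable_on {0..t}" using p'_int by blast
    show "(\<lambda>s. D * (exp (1 / \<beta> * (s - t)) * g s)) integrable_on {0..t}"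
      using g_int by (rule integrable_on_mult_right)
    show "norm (p' s) \<le> D * (exp (1 / \<beta> * (s - t)) * g s)" if "s \<in> {0..t}" for s
      using mult_left_mono[OF bound[of s], of "exp (1 / \<beta> * (s - t))"] that
      by (simp add: p'_def mult_ac)
  qed
  then have "norm (p t - p 0) \<le> D * integral {0..t} (\<lambda>s. exp (1 / \<beta> * (s - t)) * g s)"
    using p'_int by (simp add: integral_unique)
  moreover have "norm (p t) \<le> norm (p t - p 0) + norm (p 0)"
    using norm_triangle_ineq[of "p t - p 0" "p 0"] by simp
  moreover have "norm (p t) = norm (z t)" "norm (p 0) = exp (- t / \<beta>) * norm (z 0)"
    by (simp_all add: p_def)
  ultimately show ?thesis by linarith
qed

section \<open>Energy estimates along the flows\<close>

text \<open>Pairing the equation with the velocity writes the derivative of \<open>f (y s)\<close>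
  as minus the sum of the damping term and the Hessian term, both non-negative.\<close>

lemma levenberg_marquardt_descent:
  assumes "levenberg_marquardt_solution f \<beta> a x0 y" and "\<beta> > 0"
    and "twice_cont_differentiable f" and "strongly_convex_on_bounded f"
    and "\<And>t. t \<ge> 0 \<Longrightarrow> a t \<ge> 0" and "t \<ge> 0"
  shows "f (y t) \<le> f x0"
proof -
  define v where "v = time_deriv y"
  have eq: "a s *\<^sub>R v s + \<beta> *\<^sub>R hessian f (y s) (v s) + grad f (y s) = 0" if "s \<ge> 0" for s
    using assms(1) that by (simp add: levenberg_marquardt_solution_def v_def)
  have "(y has_vector_derivative v s) (at s within {0..})" if "s \<ge> 0" for s
    using assms(1) that unfolding levenberg_marquardt_solution_def v_def
    by (intro time_deriv_works) auto
  then have "((\<lambda>s. f (y s)) has_real_derivative grad f (y s) \<bullet> v s) (at s within {0..})"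
    if "s \<ge> 0" for s
    using assms(3) that by (intro grad_chain) (auto simp: twice_cont_differentiable_def)
  moreover have "grad f (y s) \<bullet> v s \<le> 0" if "s \<ge> 0" for s
  proof -
    have "a s * (v s \<bullet> v s) + \<beta> * (hessian f (y s) (v s) \<bullet> v s) + grad f (y s) \<bullet> v s = 0"
      using arg_cong[OF eq[OF that], of "\<lambda>w. w \<bullet> v s"] by (simp add: inner_add_left)
    moreover have "hessian f (y s) (v s) \<bullet> v s \<ge> 0"
      using assms(3,4) by (intro hessian_nonneg) (auto simp: twice_cont_differentiable_def)
    then have "\<beta> * (hessian f (y s) (v s) \<bullet> v s) \<ge> 0" using assms(2) by simp
    moreover have "a s * (v s \<bullet> v s) \<ge> 0" using assms(5) that by simp
    ultimately show ?thesis by linarith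
  qed
  ultimately have "f (y t) \<le> f (y 0)"
    using \<open>t \<ge> 0\<close> by (rule nonincreasing_of_time_deriv)
  then show ?thesis using assms(1) by (simp add: levenberg_marquardt_solution_def)
qed

text \<open>Pairing the equation with the velocity makes both dissipation terms lower the energy;
  the decay of the mass contributes one more term of the same sign. The bound at time 0 involves
  \<open>\<epsilon>\<close> only through \<open>\<epsilon>0\<close>.\<close>

lemma inertial_newton_energy:
  assumes sol: "inertial_newton_solution f \<beta> \<epsilon> \<alpha> x0 v0 x" and "\<beta> > 0"
    and "twice_cont_differentiable f" and "strongly_convex_on_bounded f"
    and mass: "admissible_mass c1 \<epsilon>0 \<epsilon>0' \<epsilon>" and "\<And>t. t \<ge> 0 \<Longrightarrow> \<alpha> t \<ge> 0" and "t \<ge> 0"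
  shows "f (x t) + \<epsilon> t / 2 * (norm (time_deriv x t))\<^sup>2 \<le> f x0 + \<epsilon>0 / 2 * (norm v0)\<^sup>2"
proof -
  define v where "v = time_deriv x"
  define e where "e = time_deriv \<epsilon>"
  define w where "w = time_deriv v"
  have eq: "\<epsilon> s *\<^sub>R w s + \<alpha> s *\<^sub>R v s + \<beta> *\<^sub>R hessian f (x s) (v s) + grad f (x s) = 0"
    if "s \<ge> 0" for s
    using sol that by (simp add: inertial_newton_solution_def v_def w_def)
  \<comment> \<open>This is the formal derivative of the energy; the equation of motion enters only
    when its sign is determined.\<close>
  define E' where "E' s = grad f (x s) \<bullet> v s + (e s / 2 * (v s \<bullet> v s) + \<epsilon> s * (w s \<bullet> v s))" for s
  have "((\<lambda>s. f (x s) + \<epsilon> s / 2 * (v s \<bullet> v s)) has_real_derivative E' s) (at s within {0..})"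
    if s: "s \<ge> 0" for s
  proof -
    have "(x has_vector_derivative v s) (at s within {0..})"
      using sol s unfolding inertial_newton_solution_def v_def by (intro time_deriv_works) auto
    then have "((\<lambda>s. f (x s)) has_real_derivative grad f (x s) \<bullet> v s) (at s within {0..})"
      using assms(3) by (intro grad_chain) (auto simp: twice_cont_differentiable_def)
    moreover have "(\<epsilon> has_real_derivative e s) (at s within {0..})"
      using mass s unfolding admissible_mass_def e_def has_real_derivative_iff_has_vector_derivative
      by (intro time_deriv_works) auto
    moreover have "((\<lambda>s. v s \<bullet> v s) has_real_derivative (v s \<bullet> w s + w s \<bullet> v s)) (at s within {0..})"
      unfolding has_real_derivative_iff_has_vector_derivative
      using sol s unfolding inertial_newton_solution_def v_def w_def
      by (intro bounded_bilinear.has_vector_derivative[OF bounded_bilinear_inner] time_deriv_works) auto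
    ultimately show ?thesis
      unfolding E'_def
      by (auto intro!: derivative_eq_intros simp: inner_commute algebra_simps)
  qed
  moreover have "E' s \<le> 0" if s: "s \<ge> 0" for s
  proof -
    have "\<epsilon> s * (w s \<bullet> v s) + \<alpha> s * (v s \<bullet> v s) + \<beta> * (hessian f (x s) (v s) \<bullet> v s)
        + grad f (x s) \<bullet> v s = 0"
      using arg_cong[OF eq[OF s], of "\<lambda>u. u \<bullet> v s"] by (simp add: inner_add_left)
    moreover have "hessian f (x s) (v s) \<bullet> v s \<ge> 0"
      using assms(3,4) by (intro hessian_nonneg) (auto simp: twice_cont_differentiable_def)
    then have "\<beta> * (hessian f (x s) (v s) \<bullet> v s) \<ge> 0" using assms(2) by simp
    moreover have "\<alpha> s * (v s \<bullet> v s) \<ge> 0" using assms(6) s by simp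
    moreover have "e s \<le> 0"
      using mass s unfolding admissible_mass_def e_def
      by (intro antimono_on_imp_time_deriv_nonpos) auto
    then have "e s / 2 * (v s \<bullet> v s) \<le> 0"
      by (simp add: mult_nonpos_nonneg)
    ultimately show ?thesis unfolding E'_def by linarith
  qed
  ultimately have "f (x t) + \<epsilon> t / 2 * (v t \<bullet> v t) \<le> f (x 0) + \<epsilon> 0 / 2 * (v 0 \<bullet> v 0)"
    using \<open>t \<ge> 0\<close> by (rule nonincreasing_of_time_deriv)
  then show ?thesis
    using sol mass
    by (simp add: inertial_newton_solution_def admissible_mass_def v_def power2_norm_eq_inner)
qed

section \<open>Comparison of the inertial flow with a first-order flow\<close>

text \<open>The damping \<open>a\<close> is left free between 0 and \<open>\<alpha>\<close> so that
  \<open>a = 0\<close> and \<open>a = \<alpha>\<close> give the two estimates. All constants are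
  inputs whose hypotheses mention only \<open>f\<close>, \<open>\<beta>\<close>, \<open>c1\<close>,
  \<open>c2\<close> and initial data, never the functions \<open>\<epsilon>\<close> and
  \<open>\<alpha>\<close>; this makes the estimate uniform.\<close>

lemma levenberg_marquardt_comparison:
  assumes sol: "inertial_newton_solution f \<beta> \<epsilon> \<alpha> x0 v0 x"
    and lm: "levenberg_marquardt_solution f \<beta> a x0 y"
    and \<beta>: "\<beta> > 0" and f: "twice_cont_differentiable f" "strongly_convex_on_bounded f"
    and mass: "admissible_mass c1 \<epsilon>0 \<epsilon>0' \<epsilon>"
    and damping: "admissible_damping c2 \<alpha>0 \<alpha>"
    and a: "a differentiable_on {0..}" "\<And>t. t \<ge> 0 \<Longrightarrow> 0 \<le> a t \<and> a t \<le> \<alpha> t"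
      "\<And>t. t \<ge> 0 \<Longrightarrow> \<bar>time_deriv a t\<bar> \<le> c2 * \<alpha> t"
    and c: "c1 \<ge> 0" "c2 \<ge> 0" and pos: "\<epsilon>0 > 0" "\<alpha>0 \<ge> 0"
    and R: "\<And>p. f p \<le> f x0 + \<epsilon>0 / 2 * (norm v0)\<^sup>2 \<Longrightarrow> norm p \<le> R"
    and m: "\<And>p. m \<le> f p"
    and A: "A = sqrt (2 * (f x0 + \<epsilon>0 / 2 * (norm v0)\<^sup>2 - m))"
    and \<mu>: "\<mu> > 0"
      "\<And>p q. norm p \<le> R \<Longrightarrow> norm q \<le> R \<Longrightarrow>
        (grad f p - grad f q) \<bullet> (p - q) \<ge> \<mu> * (norm (p - q))\<^sup>2"
    and D: "D = (c1 + 1 / \<beta>) * A + 2 * (c2 + 1 / \<beta>) * R"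
    and Z: "Z = \<epsilon>0 * norm v0 + 2 * \<alpha>0 * norm x0"
    and t: "t \<ge> 0"
  shows "norm (x t - y t) \<le> ((Z + D + A + 2 * R) / (\<beta> * \<mu>)) *
    (exp (- t / \<beta>) + sqrt (\<epsilon> t) + \<alpha> t
      + integral {0..t} (\<lambda>s. exp (1 / \<beta> * (s - t)) * (sqrt (\<epsilon> s) + \<alpha> s)))"
proof -
  define v where "v = time_deriv x"
  define w where "w = time_deriv v"
  define y' where "y' = time_deriv y"
  define e where "e = time_deriv \<epsilon>"
  define d where "d = time_deriv \<alpha>"
  define a' where "a' = time_deriv a"
  define M where "M = f x0 + \<epsilon>0 / 2 * (norm v0)\<^sup>2"
  define u where "u s = grad f (x s) - grad f (y s)" for s
  \<comment> \<open>\<open>r\<close> is the part of \<open>z\<close> that is directly of order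
    \<open>g\<close>. The function \<open>z'\<close> is the derivative of \<open>z\<close> after
    both equations have been substituted, so it contains neither accelerations nor Hessians.\<close>
  define r where "r s = \<epsilon> s *\<^sub>R v s + (\<alpha> s *\<^sub>R x s - a s *\<^sub>R y s)" for s
  define z where "z s = r s + \<beta> *\<^sub>R u s" for s
  define z' where "z' s = e s *\<^sub>R v s + (d s *\<^sub>R x s - a' s *\<^sub>R y s) - u s" for s
  define g where "g s = sqrt (\<epsilon> s) + \<alpha> s" for s

  have \<epsilon>_pos: "\<epsilon> s > 0" and e_bound: "\<bar>e s\<bar> \<le> c1 * \<epsilon> s" if "s \<ge> 0" for s
    using mass that by (auto simp: admissible_mass_def e_def)
  have \<alpha>_nonneg: "\<alpha> s \<ge> 0" and d_bound: "\<bar>d s\<bar> \<le> c2 * \<alpha> s" if "s \<ge> 0" for s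
    using damping that by (auto simp: admissible_damping_def d_def)
  have diff: "f differentiable (at p)" "grad f differentiable (at p)" for p
    using f(1) by (auto simp: twice_cont_differentiable_def)

  have x_deriv: "(x has_vector_derivative v s) (at s within {0..})"
    and v_deriv: "(v has_vector_derivative w s) (at s within {0..})"
    and y_deriv: "(y has_vector_derivative y' s) (at s within {0..})"
    and \<epsilon>_deriv: "(\<epsilon> has_real_derivative e s) (at s within {0..})"
    and \<alpha>_deriv: "(\<alpha> has_real_derivative d s) (at s within {0..})"
    and a_deriv: "(a has_real_derivative a' s) (at s within {0..})" if "s \<ge> 0" for s
    using sol lm mass damping a(1) that
    unfolding inertial_newton_solution_def levenberg_marquardt_solution_def admissible_mass_def
      admissible_damping_def v_def w_def y'_def e_def d_def a'_def
      has_real_derivative_iff_has_vector_derivative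
    by (auto intro: time_deriv_works)

  have energy: "f (x s) + \<epsilon> s / 2 * (norm (v s))\<^sup>2 \<le> M" if "s \<ge> 0" for s
    unfolding M_def v_def using sol \<beta> f mass \<alpha>_nonneg that by (rule inertial_newton_energy)
  have x_bound: "norm (x s) \<le> R" if "s \<ge> 0" for s
  proof -
    have "\<epsilon> s / 2 * (norm (v s))\<^sup>2 \<ge> 0" using \<epsilon>_pos[OF that] by simp
    with energy[OF that] show ?thesis by (intro R) (simp add: M_def)
  qed
  have y_bound: "norm (y s) \<le> R" if "s \<ge> 0" for s
  proof -
    have "f (y s) \<le> f x0"
      using lm \<beta> f _ that by (rule levenberg_marquardt_descent) (use a(2) in auto)
    moreover have "\<epsilon>0 / 2 * (norm v0)\<^sup>2 \<ge> 0" using pos(1) by simp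
    ultimately show ?thesis by (intro R) simp
  qed
  have "R \<ge> 0" using x_bound[of 0] norm_ge_zero[of "x 0"] by linarith
  have \<epsilon>v: "\<epsilon> s * norm (v s) \<le> A * sqrt (\<epsilon> s)" if "s \<ge> 0" for s
  proof -
    \<comment> \<open>The energy bound and the lower bound \<open>m\<close> leave at most
      \<open>M - m\<close> for the kinetic energy, whence \<open>A\<close>. Multiplying by one more
      \<open>sqrt (\<epsilon> s)\<close> gives the claim.\<close>
    have "sqrt (\<epsilon> s) * norm (v s) = sqrt (\<epsilon> s * (norm (v s))\<^sup>2)"
      by (simp add: real_sqrt_mult)
    also have "\<dots> \<le> A"
      unfolding A M_def[symmetric] using energy[OF that] m[of "x s"] by (intro real_sqrt_le_mono) simp
    finally have "sqrt (\<epsilon> s) * (sqrt (\<epsilon> s) * norm (v s)) \<le> sqrt (\<epsilon> s) * A"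
      using \<epsilon>_pos[OF that] by (intro mult_left_mono) auto
    then show ?thesis using \<epsilon>_pos[OF that] by (simp add: mult.assoc[symmetric] mult.commute)
  qed
  \<comment> \<open>The real \<open>sqrt\<close> is negative at negative arguments, so the sign has
    to be read off from the preceding estimate at time 0.\<close>
  have "A \<ge> 0"
    using \<epsilon>v[of 0] \<epsilon>_pos[of 0]
    by (smt (verit) mult_nonneg_nonneg norm_ge_zero real_sqrt_gt_zero zero_le_mult_iff)
  \<comment> \<open>Used with \<open>k = \<epsilon> s\<close>, \<open>l = 1\<close> for
    \<open>r\<close>, and with \<open>k = e s\<close>, \<open>l = c1\<close> for the residual. The
    next estimate plays the same double role for the damping, with \<open>l = 1\<close> and
    \<open>l = c2\<close>.\<close>
  have mass_term: "norm (k *\<^sub>R v s) \<le> l * (A * sqrt (\<epsilon> s))"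
    if "\<bar>k\<bar> \<le> l * \<epsilon> s" "l \<ge> 0" "s \<ge> 0" for k l s
  proof -
    have "norm (k *\<^sub>R v s) \<le> l * \<epsilon> s * norm (v s)"
      using that(1) by (simp add: mult_right_mono)
    also have "\<dots> \<le> l * (A * sqrt (\<epsilon> s))"
      using mult_left_mono[OF \<epsilon>v[OF that(3)] that(2)] by (simp add: mult.assoc)
    finally show ?thesis .
  qed
  have damping_term: "norm (k *\<^sub>R x s - k' *\<^sub>R y s) \<le> l * (2 * R * \<alpha> s)"
    if "\<bar>k\<bar> \<le> l * \<alpha> s" "\<bar>k'\<bar> \<le> l * \<alpha> s" "s \<ge> 0" for k k' l s
  proof -
    have "norm (k *\<^sub>R x s - k' *\<^sub>R y s) \<le> \<bar>k\<bar> * norm (x s) + \<bar>k'\<bar> * norm (y s)"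
      using norm_triangle_ineq4[of "k *\<^sub>R x s" "k' *\<^sub>R y s"] by simp
    also have "\<dots> \<le> (l * \<alpha> s) * R + (l * \<alpha> s) * R"
      using that x_bound[OF that(3)] y_bound[OF that(3)] by (intro add_mono mult_mono) auto
    finally show ?thesis by (simp add: algebra_simps)
  qed
  have r_bound: "norm (r s) \<le> A * sqrt (\<epsilon> s) + 2 * R * \<alpha> s" if "s \<ge> 0" for s
    using mass_term[of "\<epsilon> s" 1 s] damping_term[of "\<alpha> s" 1 s "a s"] that \<epsilon>_pos[OF that]
      \<alpha>_nonneg[OF that] a(2)[OF that]
    unfolding r_def by (intro norm_triangle_le add_mono) auto
  have g_ge: "sqrt (\<epsilon> s) \<le> g s" "\<alpha> s \<le> g s" if "s \<ge> 0" for s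
    using \<epsilon>_pos[OF that] \<alpha>_nonneg[OF that] by (auto simp: g_def)

  have z_deriv: "(z has_vector_derivative z' s) (at s within {0..})" if s: "s \<ge> 0" for s
  proof -
    have "(r has_vector_derivative
        (\<epsilon> s *\<^sub>R w s + e s *\<^sub>R v s + ((\<alpha> s *\<^sub>R v s + d s *\<^sub>R x s) - (a s *\<^sub>R y' s + a' s *\<^sub>R y s))))
        (at s within {0..})"
      unfolding r_def
      by (intro has_vector_derivative_add has_vector_derivative_diff has_vector_derivative_scaleR
          x_deriv v_deriv y_deriv \<epsilon>_deriv \<alpha>_deriv a_deriv s)
    moreover have "((\<lambda>s. \<beta> *\<^sub>R u s) has_vector_derivative
        \<beta> *\<^sub>R (hessian f (x s) (v s) - hessian f (y s) (y' s))) (at s within {0..})"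
      unfolding u_def
      by (intro bounded_linear.has_vector_derivative[OF bounded_linear_scaleR_right]
          has_vector_derivative_diff hessian_chain diff x_deriv y_deriv s)
    ultimately have z: "(z has_vector_derivative
        (\<epsilon> s *\<^sub>R w s + e s *\<^sub>R v s + ((\<alpha> s *\<^sub>R v s + d s *\<^sub>R x s) - (a s *\<^sub>R y' s + a' s *\<^sub>R y s)))
        + \<beta> *\<^sub>R (hessian f (x s) (v s) - hessian f (y s) (y' s))) (at s within {0..})"
      unfolding z_def by (rule has_vector_derivative_add)
    \<comment> \<open>Solving both equations for the gradients lets \<open>- u s\<close> in
      \<open>z'\<close> stand for exactly the acceleration, velocity and Hessian terms of the
      derivative.\<close>
    have grad_x: "grad f (x s) = - (\<epsilon> s *\<^sub>R w s + \<alpha> s *\<^sub>R v s + \<beta> *\<^sub>R hessian f (x s) (v s))"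
      using sol s by (simp only: eq_neg_iff_add_eq_0) (simp add: inertial_newton_solution_def v_def w_def add.commute)
    have grad_y: "grad f (y s) = - (a s *\<^sub>R y' s + \<beta> *\<^sub>R hessian f (y s) (y' s))"
      using lm s by (simp only: eq_neg_iff_add_eq_0) (simp add: levenberg_marquardt_solution_def y'_def add.commute)
    from z show ?thesis
      unfolding z'_def u_def grad_x grad_y by (simp add: algebra_simps)
  qed
  have z_residual: "norm (z' s + (1 / \<beta>) *\<^sub>R z s) \<le> D * g s" if s: "s \<ge> 0" for s
  proof -
    \<comment> \<open>The term \<open>- u s\<close> of \<open>z'\<close> cancels against the
      \<open>\<beta> *\<^sub>R u s\<close> contained in \<open>z s\<close>.\<close>
    have "z' s + (1 / \<beta>) *\<^sub>R z s = e s *\<^sub>R v s + (d s *\<^sub>R x s - a' s *\<^sub>R y s) + (1 / \<beta>) *\<^sub>R r s"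
      using \<beta> by (simp add: z'_def z_def scaleR_add_right)
    moreover have "norm (e s *\<^sub>R v s) \<le> c1 * (A * sqrt (\<epsilon> s))"
      using mass_term e_bound c s by blast
    moreover have "norm (d s *\<^sub>R x s - a' s *\<^sub>R y s) \<le> c2 * (2 * R * \<alpha> s)"
      using damping_term d_bound a(3) s unfolding a'_def by blast
    moreover have "norm ((1 / \<beta>) *\<^sub>R r s) \<le> 1 / \<beta> * (A * sqrt (\<epsilon> s) + 2 * R * \<alpha> s)"
      using \<beta> r_bound[OF s] by (simp add: divide_right_mono)
    ultimately have "norm (z' s + (1 / \<beta>) *\<^sub>R z s)
        \<le> c1 * (A * sqrt (\<epsilon> s)) + c2 * (2 * R * \<alpha> s) + 1 / \<beta> * (A * sqrt (\<epsilon> s) + 2 * R * \<alpha> s)"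
      by (metis (no_types, lifting) add_mono norm_triangle_le)
    also have "\<dots> = (c1 + 1 / \<beta>) * A * sqrt (\<epsilon> s) + 2 * (c2 + 1 / \<beta>) * R * \<alpha> s"
      by (simp add: algebra_simps)
    also have "\<dots> \<le> (c1 + 1 / \<beta>) * A * g s + 2 * (c2 + 1 / \<beta>) * R * g s"
      using g_ge[OF s] c \<beta> \<open>A \<ge> 0\<close> \<open>R \<ge> 0\<close> by (intro add_mono mult_left_mono) auto
    finally show ?thesis by (simp add: D algebra_simps)
  qed
  have g_cont: "continuous_on {0..} g"
    unfolding g_def
    using mass damping
    by (intro continuous_intros differentiable_imp_continuous_on)
       (auto simp: admissible_mass_def admissible_damping_def)
  define I where "I = integral {0..t} (\<lambda>s. exp (1 / \<beta> * (s - t)) * g s)"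
  have "norm (z t) \<le> exp (- t / \<beta>) * norm (z 0) + D * I"
    unfolding I_def using z_deriv z_residual g_cont \<beta> t by (rule linear_decay_estimate)
  moreover have "norm (z 0) \<le> Z"
  proof -
    have init: "x 0 = x0" "y 0 = x0" "v 0 = v0" "\<epsilon> 0 = \<epsilon>0" "\<alpha> 0 = \<alpha>0"
      using sol lm mass damping
      by (auto simp: inertial_newton_solution_def levenberg_marquardt_solution_def
          admissible_mass_def admissible_damping_def v_def)
    \<comment> \<open>Both trajectories start at \<open>x0\<close>, so the gradient difference
      vanishes at time 0.\<close>
    then have "z 0 = \<epsilon>0 *\<^sub>R v0 + (\<alpha>0 - a 0) *\<^sub>R x0"
      by (simp add: z_def r_def u_def scaleR_diff_left)
    then have "norm (z 0) \<le> norm (\<epsilon>0 *\<^sub>R v0) + norm ((\<alpha>0 - a 0) *\<^sub>R x0)"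
      using norm_triangle_ineq by metis
    moreover have "norm ((\<alpha>0 - a 0) *\<^sub>R x0) \<le> 2 * \<alpha>0 * norm x0"
      using a(2)[of 0] init by (simp add: mult_right_mono)
    ultimately show ?thesis using pos(1) by (simp add: Z)
  qed
  then have "exp (- t / \<beta>) * norm (z 0) \<le> exp (- t / \<beta>) * Z" by simp
  moreover have "\<beta> * norm (u t) \<le> norm (z t) + norm (r t)"
    using norm_triangle_ineq4[of "z t" "r t"] \<beta> by (simp add: z_def)
  ultimately have u_bound: "\<beta> * norm (u t)
      \<le> exp (- t / \<beta>) * Z + D * I + (A * sqrt (\<epsilon> t) + 2 * R * \<alpha> t)"
    using r_bound[OF t] by linarith

  \<comment> \<open>\<open>S\<close> is the bracket of the claim. Its summands are non-negative, so
    each is at most \<open>S\<close> and the coefficients can simply be added.\<close>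
  define S where "S = exp (- t / \<beta>) + sqrt (\<epsilon> t) + \<alpha> t + I"
  have "I \<ge> 0"
    unfolding I_def
  proof (rule integral_nonneg)
    show "(\<lambda>s. exp (1 / \<beta> * (s - t)) * g s) integrable_on {0..t}"
      by (intro integrable_continuous_real continuous_intros continuous_on_subset[OF g_cont]) auto
    show "0 \<le> exp (1 / \<beta> * (s - t)) * g s" if "s \<in> {0..t}" for s
      using that \<epsilon>_pos[of s] \<alpha>_nonneg[of s] by (simp add: g_def)
  qed
  then have parts: "exp (- t / \<beta>) \<le> S" "I \<le> S" "sqrt (\<epsilon> t) \<le> S" "\<alpha> t \<le> S"
    using \<epsilon>_pos[OF t] \<alpha>_nonneg[OF t] by (auto simp: S_def add_nonneg_nonneg)
  have nonneg: "Z \<ge> 0" "D \<ge> 0"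
    using pos c \<beta> \<open>A \<ge> 0\<close> \<open>R \<ge> 0\<close> by (simp_all add: Z D)
  have "exp (- t / \<beta>) * Z + D * I + (A * sqrt (\<epsilon> t) + 2 * R * \<alpha> t)
      \<le> S * Z + D * S + (A * S + 2 * R * S)"
    using parts nonneg \<open>A \<ge> 0\<close> \<open>R \<ge> 0\<close>
    by (intro add_mono mult_left_mono mult_right_mono) auto
  with u_bound have u_S: "\<beta> * norm (u t) \<le> (Z + D + A + 2 * R) * S"
    by (simp add: algebra_simps)
  \<comment> \<open>Strong monotonicity on the ball of radius \<open>R\<close> and Cauchy-Schwarz,
    divided by the distance when it is not zero.\<close>
  have "\<mu> * norm (x t - y t) \<le> norm (u t)"
  proof (cases "x t = y t")
    case False
    have "\<mu> * (norm (x t - y t))\<^sup>2 \<le> u t \<bullet> (x t - y t)"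
      unfolding u_def using \<mu>(2) x_bound y_bound t by blast
    also have "\<dots> \<le> norm (u t) * norm (x t - y t)" by (rule norm_cauchy_schwarz)
    finally show ?thesis using False by (simp add: power2_eq_square mult.assoc[symmetric])
  qed simp
  then have "\<beta> * (\<mu> * norm (x t - y t)) \<le> \<beta> * norm (u t)"
    using \<beta> by (intro mult_left_mono) auto
  with u_S have "\<beta> * (\<mu> * norm (x t - y t)) \<le> (Z + D + A + 2 * R) * S" by linarith
  then have "norm (x t - y t) \<le> (Z + D + A + 2 * R) / (\<beta> * \<mu>) * S"
    using \<beta> \<mu>(1) by (simp add: field_simps)
  then show ?thesis by (simp add: S_def I_def g_def)
qed

section \<open>Uniform constants and the two estimates\<close>

theorem theorem3p8:
  fixes f :: "'a::euclidean_space \<Rightarrow> real"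
    and \<beta> \<epsilon>0 \<alpha>0 c1 c2 :: real
    and x0 v0 :: 'a
    and x_N :: "real \<Rightarrow> 'a"
  assumes "convex_on UNIV f"
    and "twice_cont_differentiable f"
    and "coercive f"
    and "strongly_convex_on_bounded f"
    and "\<beta> > 0" and "\<epsilon>0 > 0" and "\<alpha>0 \<ge> 0"
    and "newton_solution f \<beta> x0 x_N"
    and "c1 \<ge> 0" and "c2 \<ge> 0"
  shows "\<exists>C\<ge>0. \<exists>C'\<ge>0. \<forall>\<epsilon>0'\<le>0. \<forall>\<epsilon> \<alpha>.
    admissible_mass c1 \<epsilon>0 \<epsilon>0' \<epsilon> \<longrightarrow> admissible_damping c2 \<alpha>0 \<alpha> \<longrightarrow>
    (\<forall>x. inertial_newton_solution f \<beta> \<epsilon> \<alpha> x0 v0 x \<longrightarrow>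
      (\<forall>t\<ge>0. norm (x t - x_N t) \<le>
         C * (exp (- t / \<beta>) + sqrt (\<epsilon> t) + \<alpha> t
              + integral {0..t} (\<lambda>s. exp (1 / \<beta> * (s - t)) * (sqrt (\<epsilon> s) + \<alpha> s)))) \<and>
      (\<forall>x_LM. levenberg_marquardt_solution f \<beta> \<alpha> x0 x_LM \<longrightarrow>
        (\<forall>t\<ge>0. norm (x t - x_LM t) \<le>
           C' * (exp (- t / \<beta>) + sqrt (\<epsilon> t) + \<alpha> t
                + integral {0..t} (\<lambda>s. exp (1 / \<beta> * (s - t)) * (sqrt (\<epsilon> s) + \<alpha> s))))))"
proof -
  define M where "M = f x0 + \<epsilon>0 / 2 * (norm v0)\<^sup>2"
  have "bounded {p. f p \<le> M}"
    using assms(3) by (rule coercive_bounded_sublevel)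
  then obtain R where R: "\<And>p. f p \<le> M \<Longrightarrow> norm p \<le> R"
    by (auto simp: bounded_iff)
  have "f differentiable_on UNIV"
    using assms(2) by (simp add: twice_cont_differentiable_def differentiable_on_def)
  then obtain m where m: "\<And>p. m \<le> f p"
    using coercive_bounded_below[OF assms(3)] differentiable_imp_continuous_on by blast
  \<comment> \<open>The ball of radius \<open>R\<close> contains all trajectories, so a single
    modulus of strong convexity serves for every \<open>\<epsilon>\<close> and
    \<open>\<alpha>\<close>.\<close>
  obtain \<mu> where \<mu>: "\<mu> > 0"
    "\<And>p q. norm p \<le> R \<Longrightarrow> norm q \<le> R \<Longrightarrow>
        (grad f p - grad f q) \<bullet> (p - q) \<ge> \<mu> * (norm (p - q))\<^sup>2"
    using assms(4) bounded_cball[of 0 R] unfolding strongly_convex_on_bounded_def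
    by (meson mem_cball_0)
  define A where "A = sqrt (2 * (M - m))"
  define D where "D = (c1 + 1 / \<beta>) * A + 2 * (c2 + 1 / \<beta>) * R"
  define Z where "Z = \<epsilon>0 * norm v0 + 2 * \<alpha>0 * norm x0"
  \<comment> \<open>All ingredients are fixed before \<open>\<epsilon>0'\<close>,
    \<open>\<epsilon>\<close> and \<open>\<alpha>\<close> are introduced; the same \<open>C\<close>
    is the witness for both constants.\<close>
  define C where "C = (Z + D + A + 2 * R) / (\<beta> * \<mu>)"
  have "\<epsilon>0 / 2 * (norm v0)\<^sup>2 \<ge> 0" using assms(6) by simp
  then have "f x0 \<le> M" by (simp add: M_def)
  then have "R \<ge> 0" "A \<ge> 0"
    using order_trans[OF norm_ge_zero R] order_trans[OF m] by (auto simp: A_def)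
  then have "C \<ge> 0"
    using assms(5-7,9,10) \<mu>(1) by (simp add: C_def D_def Z_def)
  have comparison: "norm (x t - y t) \<le>
      C * (exp (- t / \<beta>) + sqrt (\<epsilon> t) + \<alpha> t
        + integral {0..t} (\<lambda>s. exp (1 / \<beta> * (s - t)) * (sqrt (\<epsilon> s) + \<alpha> s)))"
    if "inertial_newton_solution f \<beta> \<epsilon> \<alpha> x0 v0 x" "levenberg_marquardt_solution f \<beta> a x0 y"
      "admissible_mass c1 \<epsilon>0 \<epsilon>0' \<epsilon>" "admissible_damping c2 \<alpha>0 \<alpha>"
      "a differentiable_on {0..}" "\<And>t. t \<ge> 0 \<Longrightarrow> 0 \<le> a t \<and> a t \<le> \<alpha> t"
      "\<And>t. t \<ge> 0 \<Longrightarrow> \<bar>time_deriv a t\<bar> \<le> c2 * \<alpha> t" "t \<ge> 0"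
    for x y a \<epsilon> \<alpha> \<epsilon>0' t
    unfolding C_def
    by (rule levenberg_marquardt_comparison[OF that(1,2) assms(5,2,4) that(3-7) assms(9,10,6,7)
          R[unfolded M_def] m A_def[unfolded M_def] \<mu> D_def Z_def that(8)])
  have newton: "levenberg_marquardt_solution f \<beta> (\<lambda>_. 0) x0 x_N"
    using assms(8) by (simp add: newton_solution_def levenberg_marquardt_solution_def)
  show ?thesis
  proof (intro exI[of _ C] conjI allI impI \<open>C \<ge> 0\<close>)
    fix \<epsilon>0' \<epsilon> \<alpha> x and t :: real
    assume mass: "admissible_mass c1 \<epsilon>0 \<epsilon>0' \<epsilon>" and damping: "admissible_damping c2 \<alpha>0 \<alpha>"
      and sol: "inertial_newton_solution f \<beta> \<epsilon> \<alpha> x0 v0 x" and t: "t \<ge> 0"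
    have \<alpha>: "\<alpha> s \<ge> 0" if "s \<ge> 0" for s
      using damping that by (simp add: admissible_damping_def)
    show "norm (x t - x_N t) \<le>
        C * (exp (- t / \<beta>) + sqrt (\<epsilon> t) + \<alpha> t
          + integral {0..t} (\<lambda>s. exp (1 / \<beta> * (s - t)) * (sqrt (\<epsilon> s) + \<alpha> s)))"
      \<comment> \<open>Here \<open>a\<close> is constantly 0, and its derivative vanishes.\<close>
      by (rule comparison[OF sol newton mass damping _ _ _ t])
         (use \<alpha> assms(10) in \<open>auto simp: time_deriv_const\<close>)
    show "norm (x t - x_LM t) \<le>
        C * (exp (- t / \<beta>) + sqrt (\<epsilon> t) + \<alpha> t
          + integral {0..t} (\<lambda>s. exp (1 / \<beta> * (s - t)) * (sqrt (\<epsilon> s) + \<alpha> s)))"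
      if "levenberg_marquardt_solution f \<beta> \<alpha> x0 x_LM" for x_LM
      \<comment> \<open>Here \<open>a = \<alpha>\<close>, so the conditions on \<open>a\<close> are
        those of an admissible damping.\<close>
      using damping \<alpha>
      by (intro comparison[OF sol that mass damping _ _ _ t]) (auto simp: admissible_damping_def)
  qed
qed

end
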